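(* Let $k,n\in\mathbb{N}$ and $m\in\mathbb{N}_0$ be such that $m\le k<n$. Then $$\mathcal{E}_m(1,\zeta_n,\ldots,\zeta_n^{k-1})=\begin{cases}\displaystyle(-1)^m\zeta_n^{mk}\prod_{j=1}^{n-k-1}\frac{1-\zeta_n^{m+j}}{1-\zeta_n^{j}} & \text{if } k\le n-2,\\[2mm] (-1)^m\zeta_n^{-m} & \text{if } k=n-1.\end{cases}$$
   Context: $\mathbb{N}=\{1,2,\ldots\}$, $\mathbb{N}_0=\mathbb{N}\cup\{0\}$, $\zeta_n:=e^{2\pi i/n}$. For complex numbers $z_1,\ldots,z_r$, the elementary symmetric polynomials are $\mathcal{E}_0(z_1,\ldots,z_r):=1$, $\mathcal{E}_m(z_1,\ldots,z_r):=\sum_{1\le j_1<\cdots<j_m\le r}z_{j_1}\cdots z_{j_m}$ for $1\le m\le r$, and $\mathcal{E}_m(z_1,\ldots,z_r):=0$ for $m>r$. *)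

theory Defs
imports Complex_Main
begin

(* The index tuples j_1 < ... < j_m are encoded by the sets {j_1, ..., j_m}, i.e. the m-element
   subsets of the index range; list positions start at 0.  The conventions for m = 0 and for
   m > r are instances of the definition: see esymm_0 and esymm_eq_0. *)
definition esymm :: "nat \<Rightarrow> complex list \<Rightarrow> complex" where
  "esymm m zs = (\<Sum>J | J \<subseteq> {..<length zs} \<and> card J = m. \<Prod>j\<in>J. zs ! j)"

lemma esymm_0: "esymm 0 zs = 1"
proof -
  have "{J. J \<subseteq> {..<length zs} \<and> card J = 0} = {{}}"
  proof -
    have "finite J" if "J \<subseteq> {..<length zs}" for J
      using that finite_lessThan by (rule finite_subset)
    then show ?thesis by (auto simp: card_eq_0_iff)
  qed
  then show ?thesis by (simp add: esymm_def)
qed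

lemma esymm_eq_0:
  assumes "length zs < m"
  shows "esymm m zs = 0"
proof -
  have "card J \<le> length zs" if "J \<subseteq> {..<length zs}" for J
    using card_mono[OF finite_lessThan that] by simp
  then have "{J. J \<subseteq> {..<length zs} \<and> card J = m} = {}"
    using assms by (metis (mono_tags, lifting) Collect_empty_eq linorder_not_less)
  then show ?thesis by (simp only: esymm_def sum.empty)
qed

definition zeta :: "nat \<Rightarrow> complex" where
  "zeta n = exp (2 * of_real pi * \<i> / of_nat n)"

end

theory Submission
imports Defs
begin

text \<open>
  For any \<open>q\<close>, the Pascal-type recurrence in the number of variables gives
  \<open>(1 - q^(m+1)) E(m+1) = (q^m - q^k) E(m)\<close> for the elementary symmetric polynomials \<open>E(m)\<close> of
  \<open>1, q, \<dots>, q^(k-1)\<close>. If \<open>q\<close> is a primitive \<open>n\<close>-th root of unity and \<open>m < k < n\<close>, the factor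
  \<open>1 - q^(m+1)\<close> is nonzero, so this determines \<open>E(m+1)\<close> from \<open>E(m)\<close>; as \<open>q^n = 1\<close>, the product
  formula satisfies the same recurrence. For \<open>k = n - 1\<close> the product is empty and
  \<open>q^(mk) = q^(-m)\<close>.
\<close>

lemma esymm_Nil_Suc: "esymm (Suc m) [] = 0"
  by (simp add: esymm_eq_0)

text \<open>Index sets are sorted by whether they contain the new last position
  \<open>length zs\<close>; deleting it from those that do leaves an arbitrary
  \<open>m\<close>-subset of the old positions.\<close>

lemma esymm_snoc:
  "esymm (Suc m) (zs @ [z]) = esymm (Suc m) zs + z * esymm m zs"
proof -
  let ?r = "length zs"
  let ?S = "\<lambda>m. {J. J \<subseteq> {..<?r} \<and> card J = m}"
  have fin: "finite (?S i)" for i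
    by (rule finite_subset[of _ "Pow {..<?r}"]) auto
  have S: "finite J" "?r \<notin> J" if "J \<in> ?S i" for J i
    using that finite_subset[of J "{..<?r}"] by auto
  have split: "{J. J \<subseteq> {..<Suc ?r} \<and> card J = Suc m} = ?S (Suc m) \<union> insert ?r ` ?S m"
    (is "?A = ?B")
  proof
    show "?A \<subseteq> ?B"
    proof
      fix J assume J: "J \<in> ?A"
      then have "finite J" using finite_subset by blast
      show "J \<in> ?B"
      proof (cases "?r \<in> J")
        case True
        then have "J - {?r} \<in> ?S m" "J = insert ?r (J - {?r})"
          using J \<open>finite J\<close> by (auto simp: less_Suc_eq)
        then show ?thesis by blast
      next
        case False
        then show ?thesis using J by (auto simp: less_Suc_eq)
      qed
    qed
    show "?B \<subseteq> ?A"
      using S by (auto simp: less_Suc_eq)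
  qed
  have disj: "?S (Suc m) \<inter> insert ?r ` ?S m = {}"
    using S(2) by blast
  have inj: "inj_on (insert ?r) (?S m)"
    using S by (meson inj_onI insert_ident)
  have nth: "(\<Prod>j\<in>J. (zs @ [z]) ! j) = (\<Prod>j\<in>J. zs ! j)" if "J \<in> ?S i" for J i
    using that by (intro prod.cong) (auto simp: nth_append)
  have "esymm (Suc m) (zs @ [z]) =
      (\<Sum>J\<in>?S (Suc m) \<union> insert ?r ` ?S m. \<Prod>j\<in>J. (zs @ [z]) ! j)"
    unfolding esymm_def by (simp add: split)
  also have "\<dots> = (\<Sum>J\<in>?S (Suc m). \<Prod>j\<in>J. (zs @ [z]) ! j) +
      (\<Sum>J\<in>insert ?r ` ?S m. \<Prod>j\<in>J. (zs @ [z]) ! j)"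
    by (intro sum.union_disjoint finite_imageI fin disj)
  also have "(\<Sum>J\<in>?S (Suc m). \<Prod>j\<in>J. (zs @ [z]) ! j) = esymm (Suc m) zs"
    unfolding esymm_def by (intro sum.cong refl nth)
  also have "(\<Sum>J\<in>insert ?r ` ?S m. \<Prod>j\<in>J. (zs @ [z]) ! j) =
      (\<Sum>J\<in>?S m. z * (\<Prod>j\<in>J. zs ! j))"
    unfolding sum.reindex[OF inj] o_def
  proof (rule sum.cong[OF refl])
    fix J assume J: "J \<in> ?S m"
    show "(\<Prod>j\<in>insert ?r J. (zs @ [z]) ! j) = z * (\<Prod>j\<in>J. zs ! j)"
      using S[OF J] nth[OF J] by simp
  qed
  also have "\<dots> = z * esymm m zs"
    unfolding esymm_def by (simp add: sum_distrib_left)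
  finally show ?thesis .
qed

text \<open>\<open>m\<close> is generalised because the step for \<open>Suc k\<close> needs the
  recurrence for \<open>k\<close> at both \<open>m\<close> and \<open>m - 1\<close>.\<close>

lemma esymm_powers_Suc:
  "(1 - q ^ Suc m) * esymm (Suc m) (map (\<lambda>i. q ^ i) [0..<k]) =
    (q ^ m - q ^ k) * esymm m (map (\<lambda>i. q ^ i) [0..<k])"
proof (induction k arbitrary: m)
  case 0
  then show ?case
    by (cases m) (simp_all add: esymm_Nil_Suc)
next
  case (Suc k)
  let ?e = "\<lambda>m. esymm m (map (\<lambda>i. q ^ i) [0..<k])"
  have step: "esymm (Suc i) (map (\<lambda>i. q ^ i) [0..<Suc k]) = ?e (Suc i) + q ^ k * ?e i" for i
    by (simp add: esymm_snoc)
  show ?case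
  proof (cases m)
    case 0
    have "(1 - q) * (?e 1 + q ^ k) = (1 - q) * ?e 1 + (1 - q) * q ^ k"
      by (rule distrib_left)
    also have "(1 - q) * ?e 1 = 1 - q ^ k"
      using Suc.IH[of 0] by (simp add: esymm_0)
    also have "1 - q ^ k + (1 - q) * q ^ k = 1 - q ^ Suc k"
      by (simp add: algebra_simps)
    finally show ?thesis
      using step[of 0] by (simp add: 0 esymm_0)
  next
    case m: (Suc l)
    \<comment> \<open>The coefficient of \<open>?e m\<close> is
      \<open>q ^ m - q ^ (m + k + 1)\<close>. Adding and subtracting \<open>q ^ Suc k\<close>
      isolates \<open>(1 - q ^ m) * ?e m\<close>, to which the hypothesis at \<open>l\<close>
      applies.\<close>
    have "(1 - q ^ Suc m) * (?e (Suc m) + q ^ k * ?e m) =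
        (q ^ m - q ^ Suc k) * ?e m + q ^ Suc k * ((1 - q ^ m) * ?e m)"
      unfolding distrib_left Suc.IH by (simp add: algebra_simps)
    also have "(1 - q ^ m) * ?e m = (q ^ l - q ^ k) * ?e l"
      using Suc.IH[of l] by (simp only: m)
    also have "(q ^ m - q ^ Suc k) * ?e m + q ^ Suc k * ((q ^ l - q ^ k) * ?e l) =
        (q ^ m - q ^ Suc k) * (?e m + q ^ k * ?e l)"
      by (simp add: m algebra_simps)
    finally show ?thesis
      using step[of m] step[of l] by (simp only: m)
  qed
qed

text \<open>On both sides the numerators run through \<open>1 - q ^ i\<close> for \<open>i\<close>
  from \<open>m + 1\<close> to \<open>m + 1 + N\<close>, over the same denominators. If a
  denominator vanishes, both sides are 0 since \<open>x / 0 = 0\<close>.\<close>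

lemma prod_one_minus_power_shift:
  fixes q :: complex
  shows "(1 - q ^ Suc m) * (\<Prod>j = 1..N. (1 - q ^ (Suc m + j)) / (1 - q ^ j)) =
    (1 - q ^ (Suc m + N)) * (\<Prod>j = 1..N. (1 - q ^ (m + j)) / (1 - q ^ j))"
proof (induction N)
  case (Suc N)
  let ?P = "\<lambda>m N. \<Prod>j = 1..N. (1 - q ^ (m + j)) / (1 - q ^ j)"
  have "(1 - q ^ Suc m) * ?P (Suc m) (Suc N) =
      ((1 - q ^ Suc m) * ?P (Suc m) N) * ((1 - q ^ (Suc m + Suc N)) / (1 - q ^ Suc N))"
    by simp
  also have "\<dots> = (1 - q ^ (Suc m + Suc N)) *
      (?P m N * ((1 - q ^ (m + Suc N)) / (1 - q ^ Suc N)))"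
    unfolding Suc.IH by simp
  also have "?P m N * ((1 - q ^ (m + Suc N)) / (1 - q ^ Suc N)) = ?P m (Suc N)"
    by simp
  finally show ?case .
qed simp

lemma esymm_powers_root_of_unity:
  fixes q :: complex
  assumes "q ^ n = 1" and prim: "\<And>i. 0 < i \<Longrightarrow> i < n \<Longrightarrow> q ^ i \<noteq> 1"
    and "m \<le> k" and "k < n"
  shows "esymm m (map (\<lambda>i. q ^ i) [0..<k]) =
    (- 1) ^ m * q ^ (m * k) * (\<Prod>j = 1..n - k - 1. (1 - q ^ (m + j)) / (1 - q ^ j))"
  using \<open>m \<le> k\<close>
proof (induction m)
  case 0
  \<comment> \<open>Each factor is a nonzero number over itself, as
    \<open>0 < j < n\<close>.\<close>
  have "(\<Prod>j = 1..n - k - 1. (1 - q ^ j) / (1 - q ^ j)) = 1"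
    by (intro prod.neutral ballI) (use prim in force)
  then show ?case by (simp add: esymm_0)
next
  case (Suc m)
  let ?P = "\<lambda>m. \<Prod>j = 1..n - k - 1. (1 - q ^ (m + j)) / (1 - q ^ j)"
  have nz: "1 - q ^ Suc m \<noteq> 0"
    using prim[of "Suc m"] Suc.prems \<open>k < n\<close> by simp
  \<comment> \<open>The top numerator of the shifted product wraps around modulo \<open>n\<close>:
    times \<open>q ^ k\<close> it becomes \<open>q ^ k - q ^ m\<close>, the negated factor of the
    recurrence. This \<open>q ^ k\<close> also raises \<open>q ^ (m * k)\<close> to
    \<open>q ^ (Suc m * k)\<close>.\<close>
  have "q ^ k * q ^ (Suc m + (n - k - 1)) = q ^ (n + m)"
    using \<open>k < n\<close> unfolding power_add[symmetric] by (intro arg_cong[where f = "power q"]) simp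
  then have wrap: "q ^ k * (1 - q ^ (Suc m + (n - k - 1))) = q ^ k - q ^ m"
    using \<open>q ^ n = 1\<close> by (simp add: right_diff_distrib power_add)
  have "(1 - q ^ Suc m) * esymm (Suc m) (map (\<lambda>i. q ^ i) [0..<k]) =
      (q ^ m - q ^ k) * ((- 1) ^ m * q ^ (m * k) * ?P m)"
    using Suc by (simp only: esymm_powers_Suc)
  also have "\<dots> = (- 1) ^ Suc m * q ^ (m * k) * ((q ^ k - q ^ m) * ?P m)"
    by (simp add: algebra_simps)
  also have "\<dots> = (- 1) ^ Suc m * q ^ (Suc m * k) * ((1 - q ^ (Suc m + (n - k - 1))) * ?P m)"
    unfolding wrap[symmetric] by (simp add: power_add)
  also have "\<dots> = (1 - q ^ Suc m) * ((- 1) ^ Suc m * q ^ (Suc m * k) * ?P (Suc m))"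
    unfolding prod_one_minus_power_shift[symmetric] by (simp only: mult_ac)
  finally show ?case
    using nz by (simp only: mult_cancel_left) simp
qed

lemma zeta_power: "zeta n ^ i = cis (2 * pi * real i / real n)"
proof -
  have "zeta n = cis (2 * pi / real n)"
    by (simp add: zeta_def cis_conv_exp mult_ac)
  then show ?thesis
    by (simp add: DeMoivre mult_ac)
qed

lemma zeta_power_self: "0 < n \<Longrightarrow> zeta n ^ n = 1"
  by (simp add: zeta_power)

text \<open>Primitivity: a cosine equal to 1 forces the angle to be a multiple of
  \<open>2 * pi\<close>, hence \<open>n\<close> to divide \<open>i\<close>.\<close>

lemma zeta_power_neq_1:
  assumes "0 < i" "i < n"
  shows "zeta n ^ i \<noteq> 1"
proof
  assume "zeta n ^ i = 1"
  then have "cos (2 * pi * real i / real n) = 1"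
    by (simp add: zeta_power complex_eq_iff)
  then obtain x :: int where "2 * pi * real i / real n = of_int x * 2 * pi"
    by (auto simp: cos_one_2pi_int)
  then have "real i = of_int x * real n"
    using assms by (simp add: field_simps)
  then have "int i = x * int n"
    by (metis of_int_eq_iff of_int_mult of_int_of_nat_eq)
  then have "int n dvd int i" by simp
  then show False
    using assms by (simp add: nat_dvd_not_less)
qed

theorem corollary1p4:
  fixes k n m :: nat
  assumes "1 \<le> k" and "1 \<le> n" and "m \<le> k" and "k < n"
  shows "(k \<le> n - 2 \<longrightarrow>
            esymm m (map (\<lambda>i. zeta n ^ i) [0..<k]) =
              (- 1) ^ m * zeta n ^ (m * k) *
              (\<Prod>j = 1..n - k - 1. (1 - zeta n ^ (m + j)) / (1 - zeta n ^ j)))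
       \<and> (k = n - 1 \<longrightarrow>
            esymm m (map (\<lambda>i. zeta n ^ i) [0..<k]) = (- 1) ^ m * zeta n powi (- int m))"
proof -
  let ?q = "zeta n"
  have root: "?q ^ n = 1"
    using \<open>1 \<le> n\<close> by (simp add: zeta_power_self)
  have E: "esymm m (map (\<lambda>i. ?q ^ i) [0..<k]) =
      (- 1) ^ m * ?q ^ (m * k) * (\<Prod>j = 1..n - k - 1. (1 - ?q ^ (m + j)) / (1 - ?q ^ j))"
    using root zeta_power_neq_1 \<open>m \<le> k\<close> \<open>k < n\<close> by (rule esymm_powers_root_of_unity)
  have powi: "?q ^ (m * k) = ?q powi (- int m)" if "k = n - 1"
  proof -
    \<comment> \<open>Since \<open>k + 1 = n\<close>, the powers \<open>?q ^ (m * k)\<close> and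
      \<open>?q ^ m\<close> multiply to \<open>(?q ^ n) ^ m = 1\<close>.\<close>
    have "m * k + m = n * m"
      using that \<open>1 \<le> n\<close> by (cases n) auto
    then have "?q ^ m * ?q ^ (m * k) = 1"
      using root by (metis mult.commute power_add power_mult power_one)
    then show ?thesis
      by (simp only: power_int_minus power_int_of_nat inverse_unique)
  qed
  show ?thesis
  proof (intro conjI impI)
    assume k: "k = n - 1"
    then have "n - k - 1 = 0" by simp
    then show "esymm m (map (\<lambda>i. ?q ^ i) [0..<k]) = (- 1) ^ m * ?q powi (- int m)"
      unfolding E powi[OF k] by simp
  qed (rule E)
qed

end
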